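(* Let $R$ be a nonzero prime left artinian ring. Then there exist a division ring $D$ and a positive integer $n$ such that $R\cong M_n(D)$.
   Context: All rings are associative and unital, not necessarily commutative. For ideals $I,J$ of $R$, $IJ$ denotes the set of all finite sums of elements $uv$ with $u\in I$, $v\in J$. A ring $R$ is prime if for all (two-sided) ideals $I$ and $J$ of $R$, $IJ=\{0\}$ implies $I=\{0\}$ or $J=\{0\}$. A left ideal is an additive subgroup $I$ of $R$ with $xu\in I$ for all $x\in R$, $u\in I$. A ring $R$ is left artinian if for every descending chain $L_1\supseteq L_2\supseteq L_3\supseteq\dots$ of left ideals of $R$ there is an $n_0\in\mathbb{N}$ such that $L_n=L_{n_0}$ for all $n\ge n_0$. A division ring is a nonzero ring in which every nonzero element is invertible. $M_n(D)$ is the ring of $n\times n$ matrices with entries in $D$, and $\cong$ denotes ring isomorphism. *)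

theory Defs
  imports
    "HOL-Algebra.Ideal_Product"
    "HOL-Algebra.QuotRing"
    "Jordan_Normal_Form.Matrix"
begin

text \<open>The zero ring satisfies this definition, so nonzeroness of a prime ring is always
  a separate assumption.\<close>

locale prime_ring = ring R for R (structure) +
  assumes prime: "\<lbrakk> ideal I R; ideal J R; ideal_prod R I J = {\<zero>} \<rbrakk> \<Longrightarrow> I = {\<zero>} \<or> J = {\<zero>}"

locale left_ideal = additive_subgroup I R + ring R for I and R (structure) +
  assumes l_closed: "\<lbrakk> x \<in> carrier R; u \<in> I \<rbrakk> \<Longrightarrow> x \<otimes> u \<in> I"

locale left_artinian_ring = ring R for R (structure) +
  assumes descending_chain_stabilizes:
    "\<lbrakk> \<And>i. left_ideal (L i) R; \<And>i. L (Suc i) \<subseteq> L i \<rbrakk>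
      \<Longrightarrow> \<exists>n0::nat. \<forall>n\<ge>n0. L n = L n0"

text \<open>The suffix avoids a clash with the type class of division rings in HOL.
  \<^const>\<open>Units\<close> consists of the elements with a two-sided inverse.\<close>

locale division_ring_struct = ring D for D (structure) +
  assumes nonzero: "carrier D \<noteq> {\<zero>}"
    and invertible: "\<lbrakk> a \<in> carrier D; a \<noteq> \<zero> \<rbrakk> \<Longrightarrow> a \<in> Units D"

text \<open>\<^const>\<open>ring_mat\<close> uses the type class operations on the entries, whereas here the entries lie
  in the carrier of a ring record \<open>D\<close>. Indices range over \<open>0, \<dots>, n - 1\<close>.\<close>

definition matrix_ring :: "('a, 'b) ring_scheme \<Rightarrow> nat \<Rightarrow> 'a mat ring" where
  "matrix_ring D n = \<lparr>
    carrier = {A \<in> carrier_mat n n. \<forall>i<n. \<forall>j<n. A $$ (i, j) \<in> carrier D},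
    monoid.mult = (\<lambda>A B. mat n n (\<lambda>(i, j). \<Oplus>\<^bsub>D\<^esub>k\<in>{..<n}. A $$ (i, k) \<otimes>\<^bsub>D\<^esub> B $$ (k, j))),
    one = mat n n (\<lambda>(i, j). if i = j then \<one>\<^bsub>D\<^esub> else \<zero>\<^bsub>D\<^esub>),
    zero = mat n n (\<lambda>(i, j). \<zero>\<^bsub>D\<^esub>),
    add = (\<lambda>A B. mat n n (\<lambda>(i, j). A $$ (i, j) \<oplus>\<^bsub>D\<^esub> B $$ (i, j)))\<rparr>"

end

theory Submission
  imports Defs "HOL-Algebra.Multiplicative_Group"
begin

text \<open>A minimal left ideal of a prime ring has the form \<open>Re\<close> for an idempotent \<open>e\<close> (Brauer), and
  \<open>D = eRe\<close> is then a division ring. Consider elements \<open>p\<^sub>i \<in> Re\<close>, \<open>q\<^sub>i \<in> eR\<close> with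
  \<open>q\<^sub>i p\<^sub>j = \<delta>\<^sub>i\<^sub>j e\<close> for \<open>i, j < n\<close>, so that the products \<open>p\<^sub>i q\<^sub>j\<close> are matrix units for the corner at
  the idempotent \<open>f = \<Sum> p\<^sub>i q\<^sub>i\<close>. As long as \<open>f \<noteq> 1\<close>, primeness provides a nonzero
  element \<open>e s (1 - f) r e\<close> of \<open>D\<close>, from which a further pair is obtained, and the left annihilator
  of the \<open>p\<^sub>i\<close> shrinks strictly. Hence the artinian condition forces \<open>f = 1\<close> at some point, and
  then \<open>x \<mapsto> (q\<^sub>i x p\<^sub>j)\<^sub>i\<^sub>j\<close> is an isomorphism onto the matrix ring.\<close>

section \<open>Left ideals\<close>

context ring
begin

lemma left_idealI:
  assumes "I \<subseteq> carrier R" "\<zero> \<in> I"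
    and add: "\<And>a b. \<lbrakk> a \<in> I; b \<in> I \<rbrakk> \<Longrightarrow> a \<oplus> b \<in> I"
    and mult: "\<And>x a. \<lbrakk> x \<in> carrier R; a \<in> I \<rbrakk> \<Longrightarrow> x \<otimes> a \<in> I"
  shows "left_ideal I R"
proof -
  \<comment> \<open>Closure under negation comes from left multiplication by
    \<open>\<ominus> \<one>\<close>.\<close>
  have "\<ominus> a \<in> I" if "a \<in> I" for a
    using mult[of "\<ominus> \<one>" a] that assms(1) by (auto simp: l_minus subset_iff)
  then have "subgroup I (add_monoid R)"
    using assms by (intro add.subgroupI) auto
  then show ?thesis
    by (intro left_ideal.intro left_ideal_axioms.intro additive_subgroup.intro ring_axioms mult)
qed

lemma left_ideal_carrier: "left_ideal (carrier R) R"
  by (rule left_idealI) auto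

lemma left_ideal_subset: "left_ideal I R \<Longrightarrow> I \<subseteq> carrier R"
  by (intro additive_subgroup.a_subset left_ideal.axioms(1))

lemma left_ideal_image_mult:
  assumes "left_ideal I R" "b \<in> carrier R"
  shows "left_ideal ((\<lambda>x. x \<otimes> b) ` I) R"
proof -
  interpret left_ideal I R by fact
  have sub: "I \<subseteq> carrier R" by (rule a_subset)
  show ?thesis
  proof (rule left_idealI)
    show "(\<lambda>x. x \<otimes> b) ` I \<subseteq> carrier R"
      using sub assms(2) by auto
    show "\<zero> \<in> (\<lambda>x. x \<otimes> b) ` I"
      using zero_closed assms(2) by (intro image_eqI[of _ _ \<zero>]) auto
  next
    fix u v assume "u \<in> (\<lambda>x. x \<otimes> b) ` I" "v \<in> (\<lambda>x. x \<otimes> b) ` I"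
    then obtain x y where "x \<in> I" "y \<in> I" "u = x \<otimes> b" "v = y \<otimes> b" by auto
    then show "u \<oplus> v \<in> (\<lambda>x. x \<otimes> b) ` I"
      using sub assms(2) by (intro image_eqI[of _ _ "x \<oplus> y"]) (auto simp: l_distr)
  next
    fix r u assume "r \<in> carrier R" "u \<in> (\<lambda>x. x \<otimes> b) ` I"
    then obtain x where "x \<in> I" "u = x \<otimes> b" by auto
    then show "r \<otimes> u \<in> (\<lambda>x. x \<otimes> b) ` I"
      using sub assms(2) \<open>r \<in> carrier R\<close>
      by (intro image_eqI[of _ _ "r \<otimes> x"]) (auto simp: m_assoc l_closed)
  qed
qed

text \<open>Serves twice: with a single \<open>b\<close>, as the kernel of right multiplication by
  \<open>b\<close> on a minimal left ideal, and with the elements \<open>p i\<close> of a frame, as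
  a measure of the part of \<open>R\<close> not yet covered.\<close>

lemma left_ideal_annihilator:
  assumes "left_ideal I R" "A \<subseteq> carrier R"
  shows "left_ideal {x \<in> I. \<forall>a\<in>A. x \<otimes> a = \<zero>} R"
proof -
  interpret left_ideal I R by fact
  show ?thesis
    using a_subset assms(2)
    by (intro left_idealI) (auto simp: l_distr m_assoc subset_iff l_closed)
qed

end

text \<open>An infinite strictly descending chain in \<open>S\<close> would have to stabilize, so
  strict inclusion is well-founded on \<open>S\<close>.\<close>

lemma (in left_artinian_ring) minimal_left_ideal:
  assumes "S \<noteq> {}" and S: "\<And>I. I \<in> S \<Longrightarrow> left_ideal I R"
  obtains M where "M \<in> S" "\<forall>I\<in>S. I \<subseteq> M \<longrightarrow> I = M"
proof -
  have "wf {(I, J). I \<in> S \<and> J \<in> S \<and> I \<subset> J}"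
    unfolding wf_iff_no_infinite_down_chain
  proof clarify
    fix L assume L: "\<forall>i. (L (Suc i), L i) \<in> {(I, J). I \<in> S \<and> J \<in> S \<and> I \<subset> J}"
    have "\<exists>n0::nat. \<forall>n\<ge>n0. L n = L n0"
      using L S by (intro descending_chain_stabilizes) auto
    then obtain n0 where "L (Suc n0) = L n0" by (meson le_Suc_eq order_refl)
    then show False using L by blast
  qed
  from wfE_min'[OF this \<open>S \<noteq> {}\<close>] that show ?thesis
    by (metis (no_types, lifting) case_prodI mem_Collect_eq psubsetI)
qed

section \<open>Minimal idempotents\<close>

text \<open>Elementwise form of primeness. If every \<open>a \<otimes> r \<otimes> b\<close> were
  zero, then \<open>I\<close>, the elements \<open>x\<close> with \<open>x R b = 0\<close>, and
  \<open>J\<close>, the elements \<open>y\<close> with \<open>I R y = 0\<close>, would be ideals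
  with zero product, one containing \<open>a\<close> and the other \<open>b\<close>. Annihilators
  replace the generated ideals, whose elements are finite sums.\<close>

lemma (in prime_ring) prime_elements:
  assumes a: "a \<in> carrier R" "a \<noteq> \<zero>" and b: "b \<in> carrier R" "b \<noteq> \<zero>"
  obtains r where "r \<in> carrier R" "a \<otimes> r \<otimes> b \<noteq> \<zero>"
proof (rule ccontr)
  assume "\<not> thesis"
  with that have ann: "a \<otimes> r \<otimes> b = \<zero>" if "r \<in> carrier R" for r
    using that by blast
  define I where "I = {x \<in> carrier R. \<forall>r\<in>carrier R. x \<otimes> r \<otimes> b = \<zero>}"
  define J where "J = {y \<in> carrier R. \<forall>x\<in>I. \<forall>r\<in>carrier R. x \<otimes> r \<otimes> y = \<zero>}"
  have I: "ideal I R"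
  proof (rule idealI)
    show "subgroup I (add_monoid R)"
      unfolding I_def using b(1)
      by (intro add.subgroupI) (auto simp: l_distr l_minus intro!: exI[of _ \<zero>])
  next
    fix x r assume x: "x \<in> I" and r: "r \<in> carrier R"
    then show "r \<otimes> x \<in> I" using b(1) by (auto simp: I_def m_assoc)
    have "(x \<otimes> r) \<otimes> s \<otimes> b = x \<otimes> (r \<otimes> s) \<otimes> b" if "s \<in> carrier R" for s
      using x r that by (simp add: I_def m_assoc)
    then show "x \<otimes> r \<in> I"
      using x r by (simp add: I_def)
  qed (rule ring_axioms)
  have I_sub: "I \<subseteq> carrier R" by (auto simp: I_def)
  have J: "ideal J R"
  proof (rule idealI)
    show "subgroup J (add_monoid R)"
      unfolding J_def using I_sub
      by (intro add.subgroupI) (auto simp: r_distr r_minus subset_iff intro!: exI[of _ \<zero>])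
  next
    fix y r assume y: "y \<in> J" and r: "r \<in> carrier R"
    have "x \<otimes> s \<otimes> (r \<otimes> y) = x \<otimes> (s \<otimes> r) \<otimes> y" if "x \<in> I" "s \<in> carrier R" for x s
      using y r I_sub that by (simp add: J_def m_assoc subset_iff)
    then show "r \<otimes> y \<in> J" using y r by (simp add: J_def)
    have "x \<otimes> s \<otimes> (y \<otimes> r) = x \<otimes> s \<otimes> y \<otimes> r" if "x \<in> I" "s \<in> carrier R" for x s
      using y r I_sub that by (simp add: J_def m_assoc subset_iff)
    then show "y \<otimes> r \<in> J" using y r by (simp add: J_def)
  qed (rule ring_axioms)
  have IJ: "x \<otimes> y = \<zero>" if "x \<in> I" "y \<in> J" for x y
  proof -
    have "x \<otimes> \<one> \<otimes> y = \<zero>" using that by (auto simp: J_def)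
    then show ?thesis using that I_sub by auto
  qed
  have "z = \<zero>" if "z \<in> ideal_prod R I J" for z
    using that by induction (auto simp: IJ)
  moreover have "\<zero> \<in> ideal_prod R I J"
    using ideal_prod_is_ideal[OF I J] by (simp add: additive_subgroup.zero_closed ideal.axioms(1))
  ultimately have "I = {\<zero>} \<or> J = {\<zero>}"
    using prime[OF I J] by blast
  moreover have "a \<in> I" using a ann by (auto simp: I_def)
  moreover have "b \<in> J" using b by (auto simp: J_def I_def)
  ultimately show False using a b by auto
qed

text \<open>The equation \<open>x \<otimes> e = x\<close> encodes membership in \<open>R e\<close>.
  The last clause says that every nonzero element of \<open>R e\<close> generates it, that is,
  \<open>R e\<close> is a minimal left ideal.\<close>

definition minimal_idempotent :: "('a, 'b) ring_scheme \<Rightarrow> 'a \<Rightarrow> bool" where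
  "minimal_idempotent R e \<longleftrightarrow> e \<in> carrier R \<and> e \<noteq> \<zero>\<^bsub>R\<^esub> \<and> e \<otimes>\<^bsub>R\<^esub> e = e \<and>
    (\<forall>x\<in>carrier R. x \<noteq> \<zero>\<^bsub>R\<^esub> \<longrightarrow> x \<otimes>\<^bsub>R\<^esub> e = x \<longrightarrow> (\<exists>y\<in>carrier R. y \<otimes>\<^bsub>R\<^esub> x = e))"

text \<open>Brauer's argument: primeness yields \<open>b\<close> in a minimal left ideal
  \<open>L\<close> with \<open>L b\<close> nonzero. By minimality, right multiplication by
  \<open>b\<close> is a bijection of \<open>L\<close>, and the preimage \<open>e\<close> of
  \<open>b\<close> is idempotent.\<close>

lemma (in prime_ring) minimal_idempotent_exists:
  assumes "left_artinian_ring R" "carrier R \<noteq> {\<zero>}"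
  obtains e where "minimal_idempotent R e"
proof -
  interpret left_artinian_ring R by fact
  have "carrier R \<in> {I. left_ideal I R \<and> I \<noteq> {\<zero>}}"
    using left_ideal_carrier assms(2) by simp
  then obtain L where L: "left_ideal L R" "L \<noteq> {\<zero>}"
    and min: "\<And>I. \<lbrakk> left_ideal I R; I \<noteq> {\<zero>}; I \<subseteq> L \<rbrakk> \<Longrightarrow> I = L"
    by (rule_tac S = "{I. left_ideal I R \<and> I \<noteq> {\<zero>}}" in minimal_left_ideal) auto
  interpret L: left_ideal L R by fact
  have sub: "L \<subseteq> carrier R" by (rule left_ideal_subset) fact
  obtain a where a: "a \<in> L" "a \<noteq> \<zero>" using L(2) L.zero_closed by blast
  obtain r where r: "r \<in> carrier R" "a \<otimes> r \<otimes> a \<noteq> \<zero>"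
    using prime_elements a sub by blast
  define b where "b = r \<otimes> a"
  have b: "b \<in> L" "b \<in> carrier R" "a \<otimes> b \<noteq> \<zero>"
    using a r sub by (auto simp: b_def L.l_closed m_assoc subset_iff)
  \<comment> \<open>This left ideal lies in \<open>L\<close> because \<open>b\<close> does, and it
    contains the nonzero element \<open>a \<otimes> b\<close>.\<close>
  have "(\<lambda>x. x \<otimes> b) ` L = L"
    using a b sub by (intro min left_ideal_image_mult L(1)) (auto intro: L.l_closed)
  then obtain e where e: "e \<in> L" "e \<otimes> b = b" using b(1) by (metis imageE)
  have "b \<noteq> \<zero>" using b(3) a sub by auto
  \<comment> \<open>The kernel of right multiplication by \<open>b\<close> misses \<open>e\<close>,
    so minimality makes it zero.\<close>
  have "{x \<in> L. \<forall>c\<in>{b}. x \<otimes> c = \<zero>} \<noteq> L"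
    using e \<open>b \<noteq> \<zero>\<close> by (metis (mono_tags, lifting) mem_Collect_eq singletonI)
  then have triv: "{x \<in> L. \<forall>c\<in>{b}. x \<otimes> c = \<zero>} = {\<zero>}"
    using min left_ideal_annihilator[OF L(1), of "{b}"] b(2) by blast
  have eR: "e \<in> carrier R" using e sub by auto
  have "e \<otimes> e \<ominus> e \<in> L"
    using e L.l_closed eR
    by (simp add: minus_eq L.a_closed L.a_inv_closed)
  moreover have "(e \<otimes> e \<ominus> e) \<otimes> b = \<zero>"
    using e eR b(2) by (simp add: minus_eq l_distr l_minus m_assoc r_neg)
  ultimately have "e \<otimes> e \<ominus> e = \<zero>" using triv by auto
  then have ee: "e \<otimes> e = e"
    using eR by simp
  have e0: "e \<noteq> \<zero>" using e(2) \<open>b \<noteq> \<zero>\<close> b(2) by auto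
  have "\<exists>y\<in>carrier R. y \<otimes> x = e" if x: "x \<in> carrier R" "x \<noteq> \<zero>" "x \<otimes> e = x" for x
  proof -
    \<comment> \<open>Since \<open>x = x \<otimes> e\<close> lies in \<open>L\<close>, minimality
      gives \<open>R x = L\<close>, which contains \<open>e\<close>.\<close>
    have "x \<in> L" using x L.l_closed[OF x(1) e(1)] by simp
    moreover have "x \<in> (\<lambda>y. y \<otimes> x) ` carrier R" using x by (intro image_eqI[of _ _ \<one>]) auto
    ultimately have "(\<lambda>y. y \<otimes> x) ` carrier R = L"
      using x by (intro min left_ideal_image_mult left_ideal_carrier) (auto intro: L.l_closed)
    then show ?thesis using e(1) by (metis imageE)
  qed
  then have "minimal_idempotent R e"
    using eR e0 ee by (simp add: minimal_idempotent_def)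
  then show ?thesis by (rule that)
qed

section \<open>The corner ring at an idempotent\<close>

text \<open>For idempotent \<open>e\<close> the carrier is \<open>e R e\<close>, written as the
  elements fixed by \<open>e\<close> on both sides so that membership is a pair of
  equations.\<close>

definition corner :: "('a, 'b) ring_scheme \<Rightarrow> 'a \<Rightarrow> 'a ring" where
  "corner R e = \<lparr>
    carrier = {x \<in> carrier R. e \<otimes>\<^bsub>R\<^esub> x = x \<and> x \<otimes>\<^bsub>R\<^esub> e = x},
    monoid.mult = monoid.mult R,
    one = e,
    zero = \<zero>\<^bsub>R\<^esub>,
    add = add R\<rparr>"

lemma corner_sel [simp]:
  "x \<in> carrier (corner R e) \<longleftrightarrow> x \<in> carrier R \<and> e \<otimes>\<^bsub>R\<^esub> x = x \<and> x \<otimes>\<^bsub>R\<^esub> e = x"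
  "monoid.mult (corner R e) = monoid.mult R"
  "\<one>\<^bsub>corner R e\<^esub> = e"
  "\<zero>\<^bsub>corner R e\<^esub> = \<zero>\<^bsub>R\<^esub>"
  "add (corner R e) = add R"
  by (simp_all add: corner_def)

context ring
begin

lemma corner_mult_closed:
  assumes "e \<in> carrier R" "x \<in> carrier (corner R e)" "y \<in> carrier (corner R e)"
  shows "x \<otimes> y \<in> carrier (corner R e)"
  using assms by (auto simp: m_assoc) (metis m_assoc)

lemma corner_ring:
  assumes e: "e \<in> carrier R" "e \<otimes> e = e"
  shows "ring (corner R e)"
proof (rule ringI)
  show "abelian_group (corner R e)"
  proof (rule abelian_groupI)
    fix x assume "x \<in> carrier (corner R e)"
    then show "\<exists>y\<in>carrier (corner R e). y \<oplus>\<^bsub>corner R e\<^esub> x = \<zero>\<^bsub>corner R e\<^esub>"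
      using e by (intro bexI[of _ "\<ominus> x"]) (auto simp: l_neg l_minus r_minus)
  qed (use e in \<open>auto simp: a_ac l_distr r_distr\<close>)
  show "monoid (corner R e)"
    using e corner_mult_closed[OF e(1)] by (intro monoidI) (auto simp: m_assoc)
qed (auto simp: l_distr r_distr)

text \<open>Minimality provides left inverses of nonzero elements. A left inverse \<open>y\<close>
  of \<open>x\<close> has a left inverse \<open>z\<close> in turn, and
  \<open>z = z \<otimes> y \<otimes> x = x\<close> makes \<open>y\<close> two-sided.\<close>

lemma corner_division_ring:
  assumes "minimal_idempotent R e"
  shows "division_ring_struct (corner R e)"
proof -
  have e: "e \<in> carrier R" "e \<noteq> \<zero>" "e \<otimes> e = e"
    using assms by (auto simp: minimal_idempotent_def)
  interpret D: ring "corner R e" by (rule corner_ring) (use e in auto)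
  \<comment> \<open>The clause \<open>y \<noteq> \<zero>\<close> allows the same fact to be applied
    to \<open>y\<close> again.\<close>
  have inv: "\<exists>y\<in>carrier (corner R e). y \<noteq> \<zero> \<and> y \<otimes> x = e"
    if x: "x \<in> carrier (corner R e)" "x \<noteq> \<zero>" for x
  proof -
    obtain y where y: "y \<in> carrier R" "y \<otimes> x = e"
      using x assms by (auto simp: minimal_idempotent_def)
    \<comment> \<open>Compressing \<open>y\<close> to \<open>e \<otimes> y \<otimes> e\<close> moves
      the left inverse into the corner.\<close>
    have *: "e \<otimes> y \<otimes> e \<otimes> x = e" using x y e by (simp add: m_assoc)
    have "e \<otimes> y \<otimes> e \<in> carrier (corner R e)"
      using e y by (simp add: m_assoc) (metis e(1,3) m_assoc m_closed)
    moreover have "e \<otimes> y \<otimes> e \<noteq> \<zero>" using * e x by auto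
    ultimately show ?thesis using * by blast
  qed
  show ?thesis
  proof unfold_locales
    have "e \<in> carrier (corner R e)" using e by simp
    then show "carrier (corner R e) \<noteq> {\<zero>\<^bsub>corner R e\<^esub>}"
      using e(2) unfolding corner_sel(4) by blast
  next
    fix x assume x: "x \<in> carrier (corner R e)" "x \<noteq> \<zero>\<^bsub>corner R e\<^esub>"
    from x(2) have "x \<noteq> \<zero>" by (simp only: corner_sel(4) not_False_eq_True)
    from inv[OF x(1) this] obtain y
      where y: "y \<in> carrier (corner R e)" "y \<noteq> \<zero>" "y \<otimes> x = e" by blast
    from inv[OF y(1,2)] obtain z where z: "z \<in> carrier (corner R e)" "z \<otimes> y = e" by blast
    have "z = z \<otimes> (y \<otimes> x)" using z(1) y(3) by simp
    also have "\<dots> = e \<otimes> x"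
      using x(1) y(1) z m_assoc[of z y x] by simp
    finally have "z = x" using x(1) by simp
    then have "x \<otimes> y = e" using z(2) by simp
    then have "\<exists>y\<in>carrier (corner R e). y \<otimes> x = e \<and> x \<otimes> y = e" using y by blast
    then show "x \<in> Units (corner R e)"
      using x(1) unfolding Units_def by simp
  qed
qed

section \<open>Matrix frames\<close>

text \<open>Matrix products over the corner are summed in \<open>corner R e\<close>, computations
  with \<open>p\<close> and \<open>q\<close> in \<open>R\<close>. The two records share addition and
  zero.\<close>

lemma corner_finsum:
  assumes "e \<in> carrier R" "e \<otimes> e = e" "finite A" "f \<in> A \<rightarrow> carrier (corner R e)"
  shows "finsum (corner R e) f A = finsum R f A"
proof -
  interpret D: ring "corner R e" by (rule corner_ring) fact+
  show ?thesis using assms(3,4)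
  proof induction
    case (insert a A)
    then have "f \<in> A \<rightarrow> carrier R" "f a \<in> carrier R" by (auto simp: Pi_def)
    with insert show ?case by (simp add: D.finsum_insert Pi_def)
  qed simp
qed

end

text \<open>As left modules, a frame splits \<open>n\<close> copies of \<open>R e\<close> off
  \<open>R\<close>: each tuple of \<open>x i\<close> in \<open>R e\<close> goes to the sum of the
  \<open>x i \<otimes> q i\<close>, and right multiplication by \<open>p j\<close> recovers
  \<open>x j\<close>. Only values of \<open>p\<close> and \<open>q\<close> below \<open>n\<close>
  are constrained, so frames grow by function update at \<open>n\<close>, starting from the empty
  frame.\<close>

locale matrix_frame = ring R for R (structure) +
  fixes e :: 'a and n :: nat and p q :: "nat \<Rightarrow> 'a"
  assumes e [simp]: "e \<in> carrier R" "e \<otimes> e = e"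
    and p [simp]: "i < n \<Longrightarrow> p i \<in> carrier R" "i < n \<Longrightarrow> p i \<otimes> e = p i"
    and q [simp]: "i < n \<Longrightarrow> q i \<in> carrier R" "i < n \<Longrightarrow> e \<otimes> q i = q i"
    and qp: "\<lbrakk> i < n; j < n \<rbrakk> \<Longrightarrow> q i \<otimes> p j = (if i = j then e else \<zero>)"
begin

text \<open>Right multiplication by \<open>total\<close> projects \<open>R\<close> onto the copies
  of \<open>R e\<close> split off; \<open>total = \<one>\<close> means that they exhaust
  \<open>R\<close>.\<close>

definition total :: 'a where
  "total = (\<Oplus>i\<in>{..<n}. p i \<otimes> q i)"

lemma total_closed [simp]: "total \<in> carrier R"
  by (auto simp: total_def intro!: finsum_closed)

lemma q_total:
  assumes "i < n"
  shows "q i \<otimes> total = q i"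
proof -
  have "q i \<otimes> total = (\<Oplus>j\<in>{..<n}. q i \<otimes> (p j \<otimes> q j))"
    unfolding total_def using assms by (intro finsum_rdistr) auto
  also have "\<dots> = (\<Oplus>j\<in>{..<n}. if i = j then q j else \<zero>)"
    using assms by (intro finsum_cong') (auto simp: qp simp flip: m_assoc)
  also have "\<dots> = q i"
    using assms by (intro finsum_singleton) auto
  finally show ?thesis .
qed

lemma total_p:
  assumes "i < n"
  shows "total \<otimes> p i = p i"
proof -
  have "total \<otimes> p i = (\<Oplus>j\<in>{..<n}. p j \<otimes> q j \<otimes> p i)"
    unfolding total_def using assms by (intro finsum_ldistr) auto
  also have "\<dots> = (\<Oplus>j\<in>{..<n}. if i = j then p j else \<zero>)"
    using assms by (intro finsum_cong') (auto simp: qp m_assoc)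
  also have "\<dots> = p i"
    using assms by (intro finsum_singleton) auto
  finally show ?thesis .
qed

section \<open>Coordinates with respect to a complete frame\<close>

definition coords :: "'a \<Rightarrow> 'a mat" where
  "coords x = mat n n (\<lambda>(i, j). q i \<otimes> x \<otimes> p j)"

lemma coords_in_corner:
  assumes "x \<in> carrier R" "i < n" "j < n"
  shows "q i \<otimes> x \<otimes> p j \<in> carrier (corner R e)"
  using assms by (simp add: m_assoc) (simp flip: m_assoc)

text \<open>Inserting \<open>\<one> = total\<close> between \<open>x\<close> and \<open>y\<close>
  produces the row-by-column sum.\<close>

lemma coords_mult:
  assumes total: "total = \<one>" and x: "x \<in> carrier R" and y: "y \<in> carrier R" and ij: "i < n" "j < n"
  shows "q i \<otimes> (x \<otimes> y) \<otimes> p j =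
    (\<Oplus>\<^bsub>corner R e\<^esub>k\<in>{..<n}. (q i \<otimes> x \<otimes> p k) \<otimes> (q k \<otimes> y \<otimes> p j))"
proof -
  have "q i \<otimes> (x \<otimes> y) \<otimes> p j = (q i \<otimes> x) \<otimes> total \<otimes> (y \<otimes> p j)"
    using x y ij by (simp add: total m_assoc)
  also have "\<dots> = (q i \<otimes> x) \<otimes> (\<Oplus>k\<in>{..<n}. (p k \<otimes> q k) \<otimes> (y \<otimes> p j))"
    unfolding total_def using x y ij by (subst m_assoc) (auto simp: finsum_ldistr Pi_def intro!: finsum_closed)
  also have "\<dots> = (\<Oplus>k\<in>{..<n}. (q i \<otimes> x) \<otimes> ((p k \<otimes> q k) \<otimes> (y \<otimes> p j)))"
    using x y ij by (intro finsum_rdistr) auto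
  also have "\<dots> = (\<Oplus>k\<in>{..<n}. (q i \<otimes> x \<otimes> p k) \<otimes> (q k \<otimes> y \<otimes> p j))"
    using x y ij by (intro finsum_cong') (auto simp: m_assoc)
  also have "\<dots> = (\<Oplus>\<^bsub>corner R e\<^esub>k\<in>{..<n}. (q i \<otimes> x \<otimes> p k) \<otimes> (q k \<otimes> y \<otimes> p j))"
    using x y ij
    by (intro corner_finsum[symmetric] Pi_I corner_mult_closed coords_in_corner) auto
  finally show ?thesis .
qed

text \<open>Inserting \<open>total = \<one>\<close> on both sides of \<open>z\<close> recovers
  \<open>z\<close> as the sum of the
  \<open>p i \<otimes> (q i \<otimes> z \<otimes> p j) \<otimes> q j\<close>, hence from its
  coordinates.\<close>

lemma coords_inject:
  assumes total: "total = \<one>" and x: "x \<in> carrier R" and y: "y \<in> carrier R"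
    and eq: "\<And>i j. \<lbrakk> i < n; j < n \<rbrakk> \<Longrightarrow> q i \<otimes> x \<otimes> p j = q i \<otimes> y \<otimes> p j"
  shows "x = y"
proof -
  have "z = (\<Oplus>i\<in>{..<n}. \<Oplus>j\<in>{..<n}. p i \<otimes> (q i \<otimes> z \<otimes> p j) \<otimes> q j)" if z: "z \<in> carrier R" for z
  proof -
    have "z = total \<otimes> (z \<otimes> total)" using z by (simp add: total)
    also have "\<dots> = (\<Oplus>i\<in>{..<n}. (p i \<otimes> q i) \<otimes> (z \<otimes> total))"
      \<comment> \<open>Only the left \<open>total\<close> is expanded here; the right one is
        expanded within each summand.\<close>
      unfolding total_def[THEN arg_cong, of "\<lambda>t. t \<otimes> (z \<otimes> total)"]
      using z by (intro finsum_ldistr) auto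
    also have "\<dots> = (\<Oplus>i\<in>{..<n}. \<Oplus>j\<in>{..<n}. p i \<otimes> (q i \<otimes> z \<otimes> p j) \<otimes> q j)"
    proof (intro finsum_cong' refl)
      fix i assume i: "i \<in> {..<n}"
      have "(p i \<otimes> q i) \<otimes> (z \<otimes> total) = (p i \<otimes> q i \<otimes> z) \<otimes> total"
        using i z by (simp add: m_assoc)
      also have "\<dots> = (\<Oplus>j\<in>{..<n}. (p i \<otimes> q i \<otimes> z) \<otimes> (p j \<otimes> q j))"
        unfolding total_def using i z by (intro finsum_rdistr) auto
      also have "\<dots> = (\<Oplus>j\<in>{..<n}. p i \<otimes> (q i \<otimes> z \<otimes> p j) \<otimes> q j)"
        using i z by (intro finsum_cong') (auto simp: m_assoc)
      finally show "(p i \<otimes> q i) \<otimes> (z \<otimes> total) = \<dots>" .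
    qed (use z in \<open>auto intro!: finsum_closed\<close>)
    finally show ?thesis .
  qed
  from this[OF x] this[OF y] show ?thesis
    using x y by (simp add: eq cong: finsum_cong)
qed

lemma coords_surj:
  assumes d: "\<And>i j. \<lbrakk> i < n; j < n \<rbrakk> \<Longrightarrow> d i j \<in> carrier (corner R e)"
  obtains x where "x \<in> carrier R" "\<forall>i<n. \<forall>j<n. q i \<otimes> x \<otimes> p j = d i j"
proof (rule that)
  \<comment> \<open>The combination of the matrix units \<open>p i \<otimes> q j\<close> with
    coefficients \<open>d i j\<close>. In the nested form \<open>q a\<close> collapses the outer sum
    and \<open>p b\<close> then the inner one.\<close>
  define x where "x = (\<Oplus>i\<in>{..<n}. p i \<otimes> (\<Oplus>j\<in>{..<n}. d i j \<otimes> q j))"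
  have dR [simp]: "d i j \<in> carrier R" "e \<otimes> d i j = d i j" "d i j \<otimes> e = d i j"
    if "i < n" "j < n" for i j using d[OF that] by auto
  show "x \<in> carrier R"
    by (auto simp: x_def intro!: finsum_closed)
  show "\<forall>i<n. \<forall>j<n. q i \<otimes> x \<otimes> p j = d i j"
  proof (intro allI impI)
    fix a b assume a: "a < n" and b: "b < n"
    have "q a \<otimes> x = (\<Oplus>i\<in>{..<n}. q a \<otimes> (p i \<otimes> (\<Oplus>j\<in>{..<n}. d i j \<otimes> q j)))"
      unfolding x_def using a by (intro finsum_rdistr) (auto intro!: finsum_closed)
    also have "\<dots> = (\<Oplus>i\<in>{..<n}. if a = i then e \<otimes> (\<Oplus>j\<in>{..<n}. d i j \<otimes> q j) else \<zero>)"
    proof (intro finsum_cong' refl)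
      fix i assume i: "i \<in> {..<n}"
      have "(\<Oplus>j\<in>{..<n}. d i j \<otimes> q j) \<in> carrier R" using i by (auto intro!: finsum_closed)
      then show "q a \<otimes> (p i \<otimes> (\<Oplus>j\<in>{..<n}. d i j \<otimes> q j)) =
          (if a = i then e \<otimes> (\<Oplus>j\<in>{..<n}. d i j \<otimes> q j) else \<zero>)"
        using a i by (auto simp: qp simp flip: m_assoc)
    qed (auto intro!: finsum_closed m_closed)
    also have "\<dots> = e \<otimes> (\<Oplus>j\<in>{..<n}. d a j \<otimes> q j)"
      using a by (intro finsum_singleton) (auto intro!: finsum_closed m_closed)
    \<comment> \<open>The factor \<open>e\<close> left by \<open>q a \<otimes> p a\<close> is
      absorbed by the corner elements \<open>d a j\<close>.\<close>
    also have "\<dots> = (\<Oplus>j\<in>{..<n}. e \<otimes> (d a j \<otimes> q j))"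
      using a by (intro finsum_rdistr) auto
    also have "\<dots> = (\<Oplus>j\<in>{..<n}. d a j \<otimes> q j)"
      using a by (intro finsum_cong') (auto simp flip: m_assoc)
    finally have "q a \<otimes> x \<otimes> p b = (\<Oplus>j\<in>{..<n}. d a j \<otimes> q j \<otimes> p b)"
      using a b by (simp add: finsum_ldistr Pi_def)
    also have "\<dots> = (\<Oplus>j\<in>{..<n}. if b = j then d a j else \<zero>)"
      using a b by (intro finsum_cong') (auto simp: qp m_assoc)
    also have "\<dots> = d a b"
      using a b by (intro finsum_singleton) auto
    finally show "q a \<otimes> x \<otimes> p b = d a b" .
  qed
qed

lemma iso_matrix_ring:
  assumes total: "total = \<one>"
  shows "R \<simeq> matrix_ring (corner R e) n"
proof -
  have "coords \<in> Ring.ring_hom R (matrix_ring (corner R e) n)"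
  proof (rule ring_hom_memI)
    fix x y assume x: "x \<in> carrier R" and y: "y \<in> carrier R"
    show "coords (x \<otimes> y) = coords x \<otimes>\<^bsub>matrix_ring (corner R e) n\<^esub> coords y"
    proof (rule eq_matI)
      fix i j assume "i < dim_row (coords x \<otimes>\<^bsub>matrix_ring (corner R e) n\<^esub> coords y)"
        "j < dim_col (coords x \<otimes>\<^bsub>matrix_ring (corner R e) n\<^esub> coords y)"
      then have ij: "i < n" "j < n" by (auto simp: matrix_ring_def)
      interpret D: ring "corner R e" by (rule corner_ring) auto
      have "(\<Oplus>\<^bsub>corner R e\<^esub>k\<in>{..<n}. (q i \<otimes> x \<otimes> p k) \<otimes> (q k \<otimes> y \<otimes> p j)) =
          (\<Oplus>\<^bsub>corner R e\<^esub>k\<in>{..<n}. coords x $$ (i, k) \<otimes> coords y $$ (k, j))"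
        using x y ij corner_mult_closed[OF e(1) coords_in_corner coords_in_corner]
        by (intro D.finsum_cong' refl Pi_I) (auto simp: coords_def simp del: corner_sel(1))
      with coords_mult[OF total x y ij] ij
      show "coords (x \<otimes> y) $$ (i, j) =
          (coords x \<otimes>\<^bsub>matrix_ring (corner R e) n\<^esub> coords y) $$ (i, j)"
        by (simp add: matrix_ring_def) (simp add: coords_def)
    qed (auto simp: matrix_ring_def coords_def)
    show "coords (x \<oplus> y) = coords x \<oplus>\<^bsub>matrix_ring (corner R e) n\<^esub> coords y"
      using x y by (intro eq_matI) (auto simp: matrix_ring_def coords_def l_distr r_distr)
  next
    fix x assume x: "x \<in> carrier R"
    then show "coords x \<in> carrier (matrix_ring (corner R e) n)"
      using coords_in_corner[OF x] by (auto simp: matrix_ring_def coords_def)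
  next
    show "coords \<one> = \<one>\<^bsub>matrix_ring (corner R e) n\<^esub>"
      by (intro eq_matI) (auto simp: matrix_ring_def coords_def qp)
  qed
  moreover have "bij_betw coords (carrier R) (carrier (matrix_ring (corner R e) n))"
    unfolding bij_betw_def
  proof (intro conjI inj_onI equalityI subsetI)
    fix x y assume x: "x \<in> carrier R" and y: "y \<in> carrier R" and eq: "coords x = coords y"
    have "q i \<otimes> x \<otimes> p j = q i \<otimes> y \<otimes> p j" if "i < n" "j < n" for i j
      using arg_cong[OF eq, of "\<lambda>A. A $$ (i, j)"] that by (simp add: coords_def)
    then show "x = y" using coords_inject[OF total x y] by blast
  next
    fix A assume A: "A \<in> carrier (matrix_ring (corner R e) n)"
    then have "A $$ (i, j) \<in> carrier (corner R e)" if "i < n" "j < n" for i j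
      using that by (simp add: matrix_ring_def)
    then obtain x where x: "x \<in> carrier R"
      and "\<forall>i<n. \<forall>j<n. q i \<otimes> x \<otimes> p j = A $$ (i, j)"
      by (rule coords_surj[of "\<lambda>i j. A $$ (i, j)"])
    then have "A = coords x"
      using A by (intro eq_matI) (auto simp: matrix_ring_def coords_def)
    then show "A \<in> coords ` carrier R" using x by blast
  next
    fix A assume "A \<in> coords ` carrier R"
    then show "A \<in> carrier (matrix_ring (corner R e) n)"
      using coords_in_corner by (auto simp: matrix_ring_def coords_def)
  qed
  ultimately show ?thesis
    by (auto simp: is_ring_iso_def ring_iso_def)
qed

end

section \<open>Existence of a complete frame\<close>

text \<open>The complement \<open>g\<close> of \<open>total\<close> is a nonzero idempotent with
  \<open>q i \<otimes> g = \<zero>\<close> and \<open>g \<otimes> p i = \<zero>\<close>. Any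
  \<open>x\<close> in \<open>g R e\<close> and \<open>y\<close> in \<open>e R g\<close> with
  \<open>y \<otimes> x = e\<close> therefore extend the frame.\<close>

lemma (in prime_ring) extend_matrix_frame:
  assumes frame: "matrix_frame R e n p q" and min_e: "minimal_idempotent R e"
    and total: "matrix_frame.total R n p q \<noteq> \<one>"
  obtains x y where "matrix_frame R e (Suc n) (p(n := x)) (q(n := y))"
proof -
  interpret matrix_frame R e n p q by fact
  have e0: "e \<noteq> \<zero>" using min_e by (simp add: minimal_idempotent_def)
  define g where "g = \<one> \<ominus> total"
  have g: "g \<in> carrier R" by (simp add: g_def)
  have g0: "g \<noteq> \<zero>" using total unfolding g_def by (metis r_right_minus_eq one_closed total_closed)
  have qg: "q i \<otimes> g = \<zero>" if "i < n" for i
    using that by (simp add: g_def minus_eq r_distr r_minus q_total r_neg)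
  have gp: "g \<otimes> p i = \<zero>" if "i < n" for i
    using that by (simp add: g_def minus_eq l_distr l_minus total_p r_neg)
  \<comment> \<open>Primeness is used twice, to connect \<open>g\<close> with \<open>e\<close> and
    then \<open>e\<close> with the result. The nonzero element obtained lies in \<open>R e\<close>,
    so minimality of \<open>e\<close> supplies \<open>t\<close>.\<close>
  obtain r where r: "r \<in> carrier R" "g \<otimes> r \<otimes> e \<noteq> \<zero>"
    using prime_elements[OF g g0 _ e0] by auto
  obtain s where s: "s \<in> carrier R" "e \<otimes> s \<otimes> (g \<otimes> r \<otimes> e) \<noteq> \<zero>"
    using prime_elements[of e "g \<otimes> r \<otimes> e"] r g e0 by auto
  obtain t where t: "t \<in> carrier R" "t \<otimes> (e \<otimes> s \<otimes> (g \<otimes> r \<otimes> e)) = e"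
    using min_e s r g unfolding minimal_idempotent_def by (auto simp: m_assoc)
  define x where "x = g \<otimes> r \<otimes> e"
  \<comment> \<open>The leading \<open>e\<close> places \<open>y\<close> in \<open>e R\<close>. Both
    \<open>x\<close> and \<open>y\<close> carry a factor \<open>g\<close>; in
    \<open>y \<otimes> x\<close> the two merge by \<open>g \<otimes> g = g\<close>.\<close>
  define y where "y = e \<otimes> t \<otimes> e \<otimes> s \<otimes> g"
  have gg: "g \<otimes> g = g"
  proof -
    have "total \<otimes> total = total"
      unfolding total_def[THEN arg_cong, of "\<lambda>u. total \<otimes> u"]
      by (subst finsum_rdistr) (auto simp: total_p total_def[symmetric] simp flip: m_assoc cong: finsum_cong)
    then show ?thesis
      by (simp add: g_def minus_eq l_distr r_distr l_minus r_minus r_neg)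
  qed
  have "y \<otimes> x = e \<otimes> (t \<otimes> (e \<otimes> s \<otimes> ((g \<otimes> g) \<otimes> r \<otimes> e)))"
    using r s t g by (simp add: x_def y_def m_assoc del: e(2))
  also have "\<dots> = e" using t by (simp add: gg)
  finally have yx: "y \<otimes> x = e" .
  have x: "x \<in> carrier R" "x \<otimes> e = x" and y: "y \<in> carrier R" "e \<otimes> y = y"
    using r s t g by (simp_all add: x_def y_def m_assoc) (simp_all flip: m_assoc)
  have "q i \<otimes> x = (q i \<otimes> g) \<otimes> (r \<otimes> e)" if "i < n" for i
    using that r g by (simp add: x_def m_assoc)
  then have qx: "q i \<otimes> x = \<zero>" if "i < n" for i using that r by (simp add: qg)
  have yp: "y \<otimes> p i = \<zero>" if "i < n" for i
    using that s t g by (simp add: y_def m_assoc gp)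
  have "matrix_frame R e (Suc n) (p(n := x)) (q(n := y))"
    by unfold_locales (use x y in \<open>auto simp: less_Suc_eq qp yx qx yp\<close>)
  then show ?thesis by (rule that)
qed

text \<open>Instead of building a sequence of frames, a frame is chosen whose left annihilator of
  the \<open>p i\<close> is minimal among all frames. Were it incomplete, its extension would have a
  strictly smaller annihilator.\<close>

lemma (in prime_ring) complete_matrix_frame_exists:
  assumes "left_artinian_ring R" and min_e: "minimal_idempotent R e"
  obtains n p q where "matrix_frame R e n p q" "matrix_frame.total R n p q = \<one>"
proof (rule ccontr)
  assume "\<not> thesis"
  with that have incomplete: "matrix_frame.total R n p q \<noteq> \<one>" if "matrix_frame R e n p q" for n p q
    using that by blast
  interpret left_artinian_ring R by fact
  have eR: "e \<in> carrier R" "e \<otimes> e = e" "e \<noteq> \<zero>" using min_e by (auto simp: minimal_idempotent_def)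
  define ann where "ann n p = {x \<in> carrier R. \<forall>a\<in>p ` {..<n}. x \<otimes> a = \<zero>}" for n :: nat and p
  define S where "S = {ann n p | n p. \<exists>q. matrix_frame R e n p q}"
  \<comment> \<open>The empty frame shows that \<open>S\<close> is nonempty.\<close>
  have "matrix_frame R e 0 p q" for p q
    by unfold_locales (use eR in auto)
  then have "ann 0 undefined \<in> S" unfolding S_def by blast
  then have "S \<noteq> {}" by blast
  moreover have "left_ideal I R" if "I \<in> S" for I
  proof -
    obtain n p q where I: "I = ann n p" and frame: "matrix_frame R e n p q"
      using \<open>I \<in> S\<close> by (auto simp: S_def)
    have "p ` {..<n} \<subseteq> carrier R" using matrix_frame.p(1)[OF frame] by auto
    then show ?thesis
      unfolding I ann_def by (intro left_ideal_annihilator left_ideal_carrier)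
  qed
  ultimately obtain M where M: "M \<in> S" "\<forall>I\<in>S. I \<subseteq> M \<longrightarrow> I = M"
    by (rule minimal_left_ideal)
  from M(1) obtain n p q where M_eq: "M = ann n p" and frame: "matrix_frame R e n p q"
    by (auto simp: S_def)
  obtain x y where ext: "matrix_frame R e (Suc n) (p(n := x)) (q(n := y))"
    using extend_matrix_frame[OF frame min_e incomplete[OF frame]] .
  interpret F: matrix_frame R e "Suc n" "p(n := x)" "q(n := y)" by (rule ext)
  have "ann (Suc n) (p(n := x)) \<subseteq> M"
    by (auto simp: M_eq ann_def lessThan_Suc)
  moreover have "ann (Suc n) (p(n := x)) \<in> S" using ext by (auto simp: S_def)
  ultimately have "ann (Suc n) (p(n := x)) = M" using M(2) by blast
  \<comment> \<open>The new \<open>y\<close> separates the annihilators: it kills every old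
    \<open>p i\<close>, but \<open>y \<otimes> x = e\<close> is nonzero.\<close>
  moreover have "y \<otimes> p i = \<zero>" if "i < n" for i
    using F.qp[of n i] that by simp
  then have "y \<in> M"
    using F.q(1)[of n] by (simp add: M_eq ann_def)
  ultimately have "y \<in> ann (Suc n) (p(n := x))" by (simp only:)
  then have "y \<otimes> x = \<zero>" by (simp add: ann_def lessThan_Suc)
  then show False
    using F.qp[of n n] eR(3) by simp
qed

theorem theorem3p1:
  fixes R :: "('a, 'b) ring_scheme"
  assumes "prime_ring R"
    and "left_artinian_ring R"
    and "carrier R \<noteq> {\<zero>\<^bsub>R\<^esub>}"
  shows "\<exists>(D :: 'a ring) (n :: nat). division_ring_struct D \<and> n > 0 \<and> R \<simeq> matrix_ring D n"
proof -
  interpret prime_ring R by fact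
  obtain e where min_e: "minimal_idempotent R e"
    using minimal_idempotent_exists assms(2,3) by blast
  obtain n p q where frame: "matrix_frame R e n p q" and total: "matrix_frame.total R n p q = \<one>\<^bsub>R\<^esub>"
    using complete_matrix_frame_exists[OF assms(2) min_e] .
  interpret matrix_frame R e n p q by (rule frame)
  \<comment> \<open>For \<open>n = 0\<close> the empty sum \<open>total\<close> is zero, so
    \<open>\<one> = \<zero>\<close> and \<open>R\<close> would be the zero ring.\<close>
  have "n > 0"
  proof (rule ccontr)
    assume "\<not> n > 0"
    then have "\<one>\<^bsub>R\<^esub> = \<zero>\<^bsub>R\<^esub>" using total unfolding total_def by simp
    then show False using assms(3) one_zeroD by blast
  qed
  then show ?thesis
    using corner_division_ring[OF min_e] iso_matrix_ring[OF total] by blast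
qed

end
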